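(* Let $\Sigma$ be a connected orientable surface of finite type with negative Euler characteristic, and consider an admissible multi-curve complex on $\Sigma$ whose vertices each consist of $N$ curves. Let $V_1$ and $V_2$ be two vertices of this complex. For every integer $k\ge 1$, if each loop of $V_1$ has curve complex distance at least $k$ from every loop of $V_2$, then \[ d_{cw}(V_1,V_2)\ \ge\ k(N-1)+1, \] where $d_{cw}$ is the distance in the 1-skeleton of the admissible multi-curve complex.
   Context: Curve complex: the graph whose vertices are isotopy classes of essential simple closed curves in $\Sigma$, two vertices being joined by an edge iff they have disjoint representatives; each edge has length one and the curve complex distance is the resulting path metric. Admissible multi-curve complex: a simplicial (cell) complex associated with $\Sigma$ such that, for some fixed natural number $N$: (1) each vertex is a collection (up to isotopy) of $N$ pairwise disjoint essential simple closed curves on $\Sigma$; (2) two vertices are joined by an edge if they differ by an admissible move. An admissible move replaces one simple curve of a vertex by another, homotopically distinct, simple closed curve, subject to a given set of conditions that includes at least the following: the new curve intersects the old one, the new curve is disjoint from the other $N-1$ curves of the vertex, and the resulting collection is again a vertex of the complex. (The set of admissible moves may be subject to further restrictions.) The distance $d_{cw}$ is the path metric on the 1-skeleton with every edge of length one. *)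

theory Defs
  imports "HOL-Analysis.Analysis" "HOL-Homology.Homology" "HOL-Library.Multiset" "HOL-Library.Extended_Nat"
begin

section \<open>Surfaces of finite type\<close>

definition surface_with_boundary :: "'a topology \<Rightarrow> bool" where
  "surface_with_boundary X \<longleftrightarrow>
     Hausdorff_space X \<and> second_countable X \<and>
     (\<forall>x \<in> topspace X. \<exists>U V. openin X U \<and> x \<in> U \<and>
        openin (top_of_set {z::complex. 0 \<le> Im z}) V \<and>
        subtopology X U homeomorphic_space top_of_set V)"

definition surface_interior :: "'a topology \<Rightarrow> 'a set" where
  "surface_interior X =
     {x \<in> topspace X. \<exists>U (V::complex set). openin X U \<and> x \<in> U \<and> open V \<and>
        subtopology X U homeomorphic_space top_of_set V}"

definition surface_boundary :: "'a topology \<Rightarrow> 'a set" where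
  "surface_boundary X = topspace X - surface_interior X"

text \<open>A compact surface, possibly with boundary, from which finitely many interior points (the
  punctures) have been removed. The closed-up surface \<open>M\<close> may be taken over the same type as \<open>X\<close>:
  all nonempty surfaces have the cardinality of the continuum.\<close>

definition finite_type_surface :: "'a topology \<Rightarrow> bool" where
  "finite_type_surface X \<longleftrightarrow>
     (\<exists>(M::'a topology) P. surface_with_boundary M \<and> compact_space M \<and>
        finite P \<and> P \<subseteq> surface_interior M \<and>
        X homeomorphic_space subtopology M (topspace M - P))"

text \<open>Orientability as a locally consistent choice of generators of the local homology groups
  \<open>H\<^sub>2(Y, Y - {x})\<close>, where \<open>Y\<close> is the interior of the surface.\<close>

definition orientable_surface :: "'a topology \<Rightarrow> bool" where
  "orientable_surface X \<longleftrightarrow>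
     (let Y = subtopology X (surface_interior X);
          loc = (\<lambda>A. relative_homology_group 2 Y (topspace Y - A))
      in \<exists>\<mu>. (\<forall>x \<in> topspace Y. \<mu> x \<in> carrier (loc {x}) \<and>
                 generate (loc {x}) {\<mu> x} = carrier (loc {x})) \<and>
             (\<forall>x \<in> topspace Y. \<exists>B. openin Y B \<and> x \<in> B \<and>
                (\<exists>m \<in> carrier (loc B). \<forall>y \<in> B.
                   hom_induced 2 Y (topspace Y - B) Y (topspace Y - {y}) id m = \<mu> y)))"

text \<open>The rank of an abelian group: the largest \<open>n\<close> such that the group contains a copy of
  \<open>\<int>\<^sup>n\<close>. It is meaningful only if these \<open>n\<close> are bounded, which is so for the homology groups
  of surfaces of finite type; these groups vanish in degrees above 2.\<close>

definition abelian_rank :: "('g, 'm) monoid_scheme \<Rightarrow> nat" where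
  "abelian_rank G = (GREATEST n. \<exists>h. h \<in> mon (free_Abelian_group {..<n}) G)"

definition surface_euler_char :: "'a topology \<Rightarrow> int" where
  "surface_euler_char X = (\<Sum>p\<le>2. (-1) ^ p * int (abelian_rank (homology_group (int p) X)))"


section \<open>Simple closed curves up to isotopy\<close>

abbreviation circle :: "complex topology" where
  "circle \<equiv> top_of_set (sphere 0 1)"

text \<open>Simple closed curves are unoriented: they are identified with their images.\<close>

definition parametrizes :: "'a topology \<Rightarrow> (complex \<Rightarrow> 'a) \<Rightarrow> 'a set \<Rightarrow> bool" where
  "parametrizes X f C \<longleftrightarrow> embedding_map circle X f \<and> f ` topspace circle = C"

definition simple_closed_curve :: "'a topology \<Rightarrow> 'a set \<Rightarrow> bool" where
  "simple_closed_curve X C \<longleftrightarrow> (\<exists>f. parametrizes X f C)"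

abbreviation freely_homotopic :: "'a topology \<Rightarrow> (complex \<Rightarrow> 'a) \<Rightarrow> (complex \<Rightarrow> 'a) \<Rightarrow> bool" where
  "freely_homotopic X f g \<equiv> homotopic_with (\<lambda>_. True) circle X f g"

definition homotopic_to_point :: "'a topology \<Rightarrow> (complex \<Rightarrow> 'a) \<Rightarrow> bool" where
  "homotopic_to_point X f \<longleftrightarrow> (\<exists>a. freely_homotopic X f (\<lambda>_. a))"

text \<open>The punctures of a surface of finite type are its ends, so a loop is homotopic to a puncture
  iff it can be pushed out of every compact set.\<close>

definition homotopic_to_puncture :: "'a topology \<Rightarrow> (complex \<Rightarrow> 'a) \<Rightarrow> bool" where
  "homotopic_to_puncture X f \<longleftrightarrow>
     (\<forall>K. compactin X K \<longrightarrow> (\<exists>g. freely_homotopic X f g \<and> g ` topspace circle \<inter> K = {}))"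

definition homotopic_to_boundary :: "'a topology \<Rightarrow> (complex \<Rightarrow> 'a) \<Rightarrow> bool" where
  "homotopic_to_boundary X f \<longleftrightarrow>
     (\<exists>B \<in> connected_components_of (subtopology X (surface_boundary X)).
        \<exists>g. parametrizes X g B \<and> freely_homotopic X f g)"

definition essential_curve :: "'a topology \<Rightarrow> 'a set \<Rightarrow> bool" where
  "essential_curve X C \<longleftrightarrow> simple_closed_curve X C \<and>
     \<not> (\<exists>f. parametrizes X f C \<and>
         (homotopic_to_point X f \<or> homotopic_to_puncture X f \<or> homotopic_to_boundary X f))"

text \<open>Isotopy is homotopy through embeddings of the circle.\<close>

definition isotopic :: "'a topology \<Rightarrow> 'a set \<Rightarrow> 'a set \<Rightarrow> bool" where
  "isotopic X C D \<longleftrightarrow>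
     (\<exists>f g. parametrizes X f C \<and> parametrizes X g D \<and>
        homotopic_with (embedding_map circle X) circle X f g)"

type_synonym 'a curve_class = "'a set set"

definition isotopy_class :: "'a topology \<Rightarrow> 'a set \<Rightarrow> 'a curve_class" where
  "isotopy_class X C = {D. isotopic X C D}"

definition disjoint_representatives :: "'a curve_class \<Rightarrow> 'a curve_class \<Rightarrow> bool" where
  "disjoint_representatives c d \<longleftrightarrow> (\<exists>C \<in> c. \<exists>D \<in> d. C \<inter> D = {})"

definition homotopically_distinct :: "'a topology \<Rightarrow> 'a curve_class \<Rightarrow> 'a curve_class \<Rightarrow> bool" where
  "homotopically_distinct X c d \<longleftrightarrow>
     \<not> (\<exists>C \<in> c. \<exists>D \<in> d. \<exists>f g. parametrizes X f C \<and> parametrizes X g D \<and> freely_homotopic X f g)"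

lemma isotopic_refl: "simple_closed_curve X C \<Longrightarrow> isotopic X C C"
  unfolding simple_closed_curve_def isotopic_def parametrizes_def
  by (metis continuous_map_in_subtopology embedding_map_def homeomorphic_imp_continuous_map
      homotopic_with_refl)

lemma isotopic_sym: "isotopic X C D \<Longrightarrow> isotopic X D C"
  unfolding isotopic_def by (metis homotopic_with_sym)

lemma isotopic_trans:
  assumes "isotopic X C D" "isotopic X D E"
  shows "isotopic X C E"
proof -
  obtain f g where fg: "parametrizes X f C" "parametrizes X g D"
      "homotopic_with (embedding_map circle X) circle X f g"
    using assms(1) by (auto simp: isotopic_def)
  obtain g' h where gh: "parametrizes X g' D" "parametrizes X h E"
      "homotopic_with (embedding_map circle X) circle X g' h"
    using assms(2) by (auto simp: isotopic_def)
  have hg: "homeomorphic_map circle (subtopology X D) g"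
    and hg': "homeomorphic_map circle (subtopology X D) g'"
    using fg gh by (auto simp: parametrizes_def embedding_map_def)
  obtain r where r: "homeomorphic_maps circle (subtopology X D) g r"
    using hg by (auto simp: homeomorphic_map_maps)
  define \<phi> where "\<phi> = r \<circ> g'"
  have hphi: "homeomorphic_map circle circle \<phi>"
    unfolding \<phi>_def using hg' r homeomorphic_map_compose homeomorphic_map_maps homeomorphic_maps_sym
    by blast
  have surj: "\<phi> ` topspace circle = topspace circle"
    using hphi by (rule homeomorphic_imp_surjective_map)
  have gphi: "(g \<circ> \<phi>) z = g' z" if "z \<in> topspace circle" for z
  proof -
    have "g' z \<in> topspace (subtopology X D)"
      using hg' that homeomorphic_imp_surjective_map by blast
    then show ?thesis
      using r by (simp add: \<phi>_def homeomorphic_maps_def)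
  qed
  have emb: "embedding_map circle X (k \<circ> \<phi>)" if "embedding_map circle X k" for k
  proof -
    have "embedding_map circle circle \<phi>"
      unfolding embedding_map_def surj using hphi by (simp only: subtopology_topspace)
    then show ?thesis
      using that by (rule embedding_map_compose)
  qed
  have 1: "homotopic_with (embedding_map circle X) circle X (f \<circ> \<phi>) (g \<circ> \<phi>)"
    using homotopic_with_compose_continuous_map_right
        [OF fg(3) homeomorphic_imp_continuous_map[OF hphi]] emb
    by blast
  have 2: "homotopic_with (embedding_map circle X) circle X (g \<circ> \<phi>) h"
    by (rule homotopic_with_eq[OF gh(3)])
       (use gphi in \<open>auto intro: embedding_map_eq\<close>)
  have "parametrizes X (f \<circ> \<phi>) C"
    using fg(1) emb surj unfolding parametrizes_def by (metis image_comp)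
  with gh(2) homotopic_with_trans[OF 1 2] show ?thesis
    by (auto simp: isotopic_def)
qed


section \<open>The curve complex\<close>

text \<open>The distance is \<open>\<infinity>\<close> for vertices in different components.\<close>

definition path_metric :: "('v \<Rightarrow> 'v \<Rightarrow> bool) \<Rightarrow> 'v \<Rightarrow> 'v \<Rightarrow> enat" where
  "path_metric adj x y = (INF n \<in> {n. (adj ^^ n) x y}. enat n)"

definition curve_complex_vertices :: "'a topology \<Rightarrow> 'a curve_class set" where
  "curve_complex_vertices X = isotopy_class X ` {C. essential_curve X C}"

definition curve_complex_edge :: "'a topology \<Rightarrow> 'a curve_class \<Rightarrow> 'a curve_class \<Rightarrow> bool" where
  "curve_complex_edge X c d \<longleftrightarrow>
     c \<in> curve_complex_vertices X \<and> d \<in> curve_complex_vertices X \<and> c \<noteq> d \<and>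
     disjoint_representatives c d"

definition curve_complex_dist :: "'a topology \<Rightarrow> 'a curve_class \<Rightarrow> 'a curve_class \<Rightarrow> enat" where
  "curve_complex_dist X = path_metric (curve_complex_edge X)"


section \<open>Admissible multi-curve complexes\<close>

text \<open>A multiset of isotopy classes, because disjoint curves of a collection are not required to
  be pairwise non-isotopic.\<close>

definition multicurve :: "'a topology \<Rightarrow> nat \<Rightarrow> 'a curve_class multiset \<Rightarrow> bool" where
  "multicurve X N V \<longleftrightarrow>
     (\<exists>\<C>. finite \<C> \<and> card \<C> = N \<and> pairwise disjnt \<C> \<and> (\<forall>C \<in> \<C>. essential_curve X C) \<and>
        V = image_mset (isotopy_class X) (mset_set \<C>))"

text \<open>Only the 1-skeleton of the complex is recorded: its vertex set \<open>\<V>\<close> and its admissible moves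
  \<open>move\<close>. As \<open>move\<close> is an arbitrary relation satisfying the minimal conditions, it may be subject
  to any further restrictions. It need not be symmetric; edges are nevertheless unoriented.\<close>

locale admissible_multicurve_complex =
  fixes X :: "'a topology" and N :: nat and \<V> :: "'a curve_class multiset set"
    and move :: "'a curve_class multiset \<Rightarrow> 'a curve_class multiset \<Rightarrow> bool"
  assumes vertex: "V \<in> \<V> \<Longrightarrow> multicurve X N V"
    and move: "move V W \<Longrightarrow>
      V \<in> \<V> \<and> W \<in> \<V> \<and>
      (\<exists>c c' R. V = add_mset c R \<and> W = add_mset c' R \<and>
         c' \<in> curve_complex_vertices X \<and>
         homotopically_distinct X c c' \<and>
         \<not> disjoint_representatives c c' \<and>
         (\<forall>d \<in># R. disjoint_representatives c' d))"

definition multicurve_complex_dist ::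
  "('a curve_class multiset \<Rightarrow> 'a curve_class multiset \<Rightarrow> bool) \<Rightarrow>
   'a curve_class multiset \<Rightarrow> 'a curve_class multiset \<Rightarrow> enat" where
  "multicurve_complex_dist move = path_metric (\<lambda>V W. move V W \<or> move W V)"

end

(* Curves of one vertex are pairwise at distance at most 1. Let f(c) be the curve complex distance
   from V1 to c. If a move brings in the first curve with f \<ge> m, then the N - 1 curves that it keeps
   all have f \<ge> m - 1. By induction on n, a vertex reached in n moves that has j > 0 curves with
   f \<ge> m therefore satisfies n \<ge> (m - 1) * (N - 1) + j. At V2 take m = k and j = N. *)

theory Submission
  imports Defs
begin

lemma path_metric_refl: "path_metric adj x x = 0"
proof -
  have "path_metric adj x x \<le> enat 0"
    unfolding path_metric_def by (rule INF_lower) simp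
  then show ?thesis
    by (simp add: zero_enat_def [symmetric])
qed

lemma path_metric_step:
  assumes "adj y z"
  shows "path_metric adj x z \<le> path_metric adj x y + 1"
proof (cases "{n. (adj ^^ n) x y} = {}")
  case True
  then have "path_metric adj x y = \<infinity>"
    by (simp add: path_metric_def top_enat_def)
  then show ?thesis
    by simp
next
  case False
  then obtain n0 where "enat n0 \<in> enat ` {n. (adj ^^ n) x y}"
    by auto
  \<comment> \<open>A nonempty set of extended naturals attains its infimum, so a finite distance is
    the length of an actual path, which one more edge extends.\<close>
  then have "path_metric adj x y \<in> enat ` {n. (adj ^^ n) x y}"
    unfolding path_metric_def by (rule wellorder_InfI)
  then obtain n where n: "(adj ^^ n) x y" "path_metric adj x y = enat n"
    by auto
  have "(adj ^^ Suc n) x z"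
    using n(1) assms by auto
  then have "path_metric adj x z \<le> enat (Suc n)"
    unfolding path_metric_def by (intro INF_lower) simp
  then show ?thesis
    by (simp add: n(2) one_enat_def)
qed

lemma multicurve_size: "multicurve X N V \<Longrightarrow> size V = N"
  by (auto simp: multicurve_def)

lemma multicurve_add_mset:
  assumes "multicurve X N (add_mset c R)" and "r \<in># R"
  shows "c \<in> curve_complex_vertices X" "r \<in> curve_complex_vertices X"
    "disjoint_representatives r c"
proof -
  obtain \<C> where \<C>: "finite \<C>" "pairwise disjnt \<C>" "\<forall>C \<in> \<C>. essential_curve X C"
      and eq: "image_mset (isotopy_class X) (mset_set \<C>) = add_mset c R"
    using assms(1) by (auto simp: multicurve_def)
  obtain C M where C: "mset_set \<C> = add_mset C M" "c = isotopy_class X C"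
      "R = image_mset (isotopy_class X) M"
    using msed_map_invR[OF eq] by auto
  obtain D where D: "D \<in># M" "r = isotopy_class X D"
    using assms(2) C(3) by auto
  have mem: "C \<in> \<C>" "D \<in> \<C>"
    using arg_cong[OF C(1), of set_mset] D(1) \<C>(1) by auto
  \<comment> \<open>\<open>mset_set\<close> has no repetitions. So even when \<open>r = c\<close>,
    the two entries come from different, hence disjoint, curves.\<close>
  have "count (mset_set \<C>) C \<le> 1"
    by (simp add: count_mset_set')
  then have "C \<notin># M"
    by (simp add: C(1) not_in_iff)
  then have "C \<noteq> D"
    using D(1) by auto
  then have "D \<inter> C = {}"
    using \<C>(2) mem by (auto simp: pairwise_def disjnt_def)
  moreover have "C \<in> c" "D \<in> r"
    using \<C>(3) mem by (auto simp: C(2) D(2) isotopy_class_def essential_curve_def intro: isotopic_refl)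
  ultimately show "disjoint_representatives r c"
    by (auto simp: disjoint_representatives_def)
  show "c \<in> curve_complex_vertices X" "r \<in> curve_complex_vertices X"
    using \<C>(3) mem by (auto simp: C(2) D(2) curve_complex_vertices_def)
qed

text \<open>Disjoint curves of one vertex represent either the same class or two adjacent classes.
  The first case needs its own treatment because the curve complex has no edge from a class to
  itself.\<close>

lemma curve_complex_dist_multicurve:
  assumes "multicurve X N (add_mset c R)" and "r \<in># R"
  shows "curve_complex_dist X b c \<le> curve_complex_dist X b r + 1"
proof (cases "r = c")
  case True
  then show ?thesis
    by simp
next
  case False
  then have "curve_complex_edge X r c"
    using multicurve_add_mset[OF assms] by (auto simp: curve_complex_edge_def)
  then show ?thesis
    unfolding curve_complex_dist_def by (rule path_metric_step)
qed

text \<open>Quantifying over \<open>V0\<close> expresses distance at least \<open>m\<close> from the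
  whole vertex without forming a minimum. Isotopic curves are counted separately, as a move replaces
  only one of them.\<close>

definition far_curves ::
  "'a topology \<Rightarrow> 'a curve_class multiset \<Rightarrow> nat \<Rightarrow> 'a curve_class multiset \<Rightarrow> 'a curve_class multiset"
  where
  "far_curves X V0 m V = {#c \<in># V. \<forall>b \<in># V0. enat m \<le> curve_complex_dist X b c#}"

lemma far_curves_self: "m \<ge> 1 \<Longrightarrow> far_curves X V m V = {#}"
  by (auto simp: far_curves_def filter_mset_eq_conv curve_complex_dist_def path_metric_refl
      zero_enat_def intro!: bexI)

text \<open>Companions of \<open>c\<close> in the same vertex are at most 1 closer to each
  \<open>b\<close> than \<open>c\<close> is, which costs one level.\<close>

lemma far_curves_companions:
  assumes "multicurve X N (add_mset c R)"
    and "\<forall>b \<in># V0. enat (Suc m) \<le> curve_complex_dist X b c"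
  shows "far_curves X V0 m R = R"
proof -
  have "enat m \<le> curve_complex_dist X b r" if "r \<in># R" "b \<in># V0" for r b
  proof -
    have "enat (Suc m) \<le> curve_complex_dist X b r + 1"
      using assms(2) that(2) curve_complex_dist_multicurve[OF assms(1) that(1), of b]
      by (blast intro: order_trans)
    then show ?thesis
      by (cases "curve_complex_dist X b r") (auto simp: one_enat_def)
  qed
  then show ?thesis
    by (auto simp: far_curves_def filter_mset_eq_conv)
qed

context admissible_multicurve_complex
begin

text \<open>Reversing a move only exchanges \<open>c\<close> and \<open>c'\<close>, so both
  orientations of an edge have the same form.\<close>

lemma edgeE:
  assumes "move V W \<or> move W V"
  obtains c c' R where "V = add_mset c R" "W = add_mset c' R" "multicurve X N W"
  using assms
proof
  assume "move V W"
  from move[OF this] show thesis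
    using that vertex by blast
next
  assume "move W V"
  from move[OF this] show thesis
    using that vertex by blast
qed

text \<open>Without a far curve the bound can fail, for instance at \<open>n = 0\<close> with
  \<open>m\<close> and \<open>N\<close> at least 2. The level \<open>m\<close> varies in the
  induction, which also descends to \<open>m - 1\<close>.\<close>

lemma far_curves_path_length:
  assumes "((\<lambda>V W. move V W \<or> move W V) ^^ n) V0 W"
    and "m \<ge> 1" and "far_curves X V0 m W \<noteq> {#}"
  shows "(m - 1) * (N - 1) + size (far_curves X V0 m W) \<le> n"
  using assms
proof (induction n arbitrary: W m)
  case 0
  then show ?case
    by (simp add: far_curves_self)
next
  case (Suc n)
  then obtain V where V: "((\<lambda>V W. move V W \<or> move W V) ^^ n) V0 V" "move V W \<or> move W V"
    by auto
  obtain c c' R where V_eq: "V = add_mset c R" and W_eq: "W = add_mset c' R"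
      and W: "multicurve X N W"
    using V(2) by (rule edgeE)
  have "size (far_curves X V0 m W) \<le> Suc (size (far_curves X V0 m R))"
    and RV: "size (far_curves X V0 m R) \<le> size (far_curves X V0 m V)"
    by (auto simp: far_curves_def V_eq W_eq)
  then have le: "size (far_curves X V0 m W) \<le> Suc (size (far_curves X V0 m V))"
    by linarith
  show ?case
  proof (cases "far_curves X V0 m V = {#}")
    \<comment> \<open>The level \<open>m\<close> was reached earlier, and this move adds at most one
      far curve, paid for by its own length.\<close>
    case False
    then show ?thesis
      using Suc.IH[OF V(1) Suc.prems(2)] le by linarith
  next
    case True
    then have one: "size (far_curves X V0 m W) \<le> 1" and "far_curves X V0 m R = {#}"
      using le RV by auto
    \<comment> \<open>\<open>W\<close> has a far curve but the kept part \<open>R\<close> has none,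
      so the new curve \<open>c'\<close> is the far one.\<close>
    then have c': "\<forall>b \<in># V0. enat m \<le> curve_complex_dist X b c'"
      using Suc.prems(3) by (auto simp: far_curves_def W_eq split: if_splits)
    have size_R: "N - 1 = size R"
      using multicurve_size[OF W] by (simp add: W_eq)
    show ?thesis
    \<comment> \<open>In these cases the product vanishes and the claim is
      \<open>1 \<le> Suc n\<close>. Otherwise the hypothesis applies to \<open>V\<close> one level
      lower.\<close>
    proof (cases "m = 1 \<or> R = {#}")
      case True
      then show ?thesis
        using one size_R by auto
    next
      case False
      then obtain l where l: "m = Suc l" "l \<ge> 1"
        using Suc.prems(2) by (cases m) auto
      have "far_curves X V0 l R = R"
        using far_curves_companions[of X N c' R] W c' by (simp add: W_eq l(1))
      then have "R \<subseteq># far_curves X V0 l V"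
        by (auto simp: V_eq far_curves_def)
      then have size_le: "size R \<le> size (far_curves X V0 l V)" and "far_curves X V0 l V \<noteq> {#}"
        using False by (auto intro: size_mset_mono)
      then have "(l - 1) * (N - 1) + size R \<le> n"
        using Suc.IH[OF V(1) l(2)] by linarith
      \<comment> \<open>The \<open>N - 1\<close> kept curves, all far at level \<open>l\<close>,
        supply exactly the increase of the product from level \<open>l\<close> to level
        \<open>m\<close>.\<close>
      moreover have "(m - 1) * (N - 1) = (l - 1) * (N - 1) + size R"
        using l unfolding size_R by (cases l) auto
      ultimately show ?thesis
        using one by linarith
    qed
  qed
qed

end

theorem theoremA:
  fixes S :: "'a topology" and N k :: nat
    and \<V> :: "'a curve_class multiset set"
    and move :: "'a curve_class multiset \<Rightarrow> 'a curve_class multiset \<Rightarrow> bool"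
    and V1 V2 :: "'a curve_class multiset"
  assumes "finite_type_surface S" and "connected_space S" and "orientable_surface S"
    and "surface_euler_char S < 0"
    and "admissible_multicurve_complex S N \<V> move"
    and "V1 \<in> \<V>" and "V2 \<in> \<V>"
    and "k \<ge> 1"
    and "\<forall>c \<in># V1. \<forall>d \<in># V2. enat k \<le> curve_complex_dist S c d"
  shows "ereal_of_enat (multicurve_complex_dist move V1 V2) \<ge> ereal (real k * (real N - 1) + 1)"
proof (cases "N = 0")
  case True
  \<comment> \<open>Here \<open>real N - 1\<close> is -1, so the bound is \<open>1 - k\<close>;
    subtraction in the naturals would give 0 for \<open>N - 1\<close> instead.\<close>
  then have "ereal (real k * (real N - 1) + 1) \<le> 0"
    using \<open>k \<ge> 1\<close> by simp
  also have "0 \<le> ereal_of_enat (multicurve_complex_dist move V1 V2)"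
    by simp
  finally show ?thesis .
next
  case False
  interpret admissible_multicurve_complex S N \<V> move
    by fact
  have far: "far_curves S V1 k V2 = V2"
    using assms(9) by (auto simp: far_curves_def filter_mset_eq_conv)
  have size: "size V2 = N"
    using vertex[OF \<open>V2 \<in> \<V>\<close>] by (rule multicurve_size)
  have eq: "(k - 1) * (N - 1) + N = k * (N - 1) + 1"
    using False \<open>k \<ge> 1\<close> by (cases k; cases N) auto
  have "V2 \<noteq> {#}"
    using False size by auto
  then have "k * (N - 1) + 1 \<le> n" if "((\<lambda>V W. move V W \<or> move W V) ^^ n) V1 V2" for n
    using far_curves_path_length[OF that \<open>k \<ge> 1\<close>] by (simp only: far size eq simp_thms)
  \<comment> \<open>If no path joins the vertices, the infimum is over the empty set and equals
    \<open>\<infinity>\<close>.\<close>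
  then have "enat (k * (N - 1) + 1) \<le> multicurve_complex_dist move V1 V2"
    unfolding multicurve_complex_dist_def path_metric_def by (intro INF_greatest) simp
  then have "ereal_of_enat (enat (k * (N - 1) + 1)) \<le> ereal_of_enat (multicurve_complex_dist move V1 V2)"
    by (simp only: ereal_of_enat_le_iff)
  moreover have "real (k * (N - 1) + 1) = real k * (real N - 1) + 1"
    using False by (simp add: of_nat_diff)
  ultimately show ?thesis
    by (simp only: ereal_of_enat_simps)
qed

end
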